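(* Let $G=(V,E,L,\ell)$ be an edge-labeled hypergraph with label set $L=\{1,\dots,k\}$, and for $\beta\in\mathbb{R}$ consider the problem of maximizing, over all clusterings $\mathcal{C}$ (assignments of exactly one color of $L$ to each node), the objective $$\sum_{i\in L}\bigl[E(i)+\beta D(i)\bigr],$$ where $E(i)=\sum_{v\in\mathcal{C}(i)}d_v^i$ and $D(i)=\sum_{v\in\mathcal{C}(i)}\sum_{c\in L,\,c\neq i}d_v^c$. Then a majority vote clustering is optimal (attains the maximum) for all $\beta<1$, and a minority vote clustering is optimal for all $\beta>1$. Both are optimal when $\beta=1$.
   Context: $G=(V,E,L,\ell)$ is a finite hypergraph with labeled hyperedges: $V$ is the node set, $E$ the set of hyperedges, $L=\{1,\dots,k\}$ the set of labels ("colors"), and $\ell\colon E\to L$ assigns a color to each hyperedge. For $v\in V$ and $c\in L$, the color degree $d_v^c$ is the number of hyperedges of color $c$ that contain $v$. A clustering $\mathcal{C}$ assigns each node to exactly one color in $L$; $\mathcal{C}(i)$ denotes the set of nodes assigned to color $i$. A majority vote clustering is a clustering in which each node $v$ is placed in a cluster $\mathcal{C}(i)$ with $i\in\operatorname{argmax}_{c\in L}d_v^c$. A minority vote clustering is a clustering in which each node $v$ is placed in a cluster $\mathcal{C}(i)$ with $i\in\operatorname{argmin}_{c\in L}d_v^c$ (ties in either case may be broken arbitrarily). *)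

theory Defs
  imports Complex_Main "HOL-Library.FuncSet"
begin

text \<open>Hyperedges are abstract objects with a node set attached, so that parallel hyperedges
  (the same node set, possibly with different labels) are covered. Hypergraphs whose hyperedges
  are subsets of the node set are the case where the map \<open>members\<close> is the identity.\<close>

record ('a, 'e) hypergraph =
  nodes :: "'a set"
  hyperedges :: "'e set"
  members :: "'e \<Rightarrow> 'a set"
  num_labels :: nat
  edge_label :: "'e \<Rightarrow> nat"

definition labels :: "('a, 'e) hypergraph \<Rightarrow> nat set" where
  "labels G = {1..num_labels G}"

definition labeled_hypergraph :: "('a, 'e) hypergraph \<Rightarrow> bool" where
  "labeled_hypergraph G \<longleftrightarrow>
     finite (nodes G) \<and> finite (hyperedges G) \<and>
     members G \<in> hyperedges G \<rightarrow> Pow (nodes G) \<and>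
     edge_label G \<in> hyperedges G \<rightarrow> labels G"

definition color_degree :: "('a, 'e) hypergraph \<Rightarrow> 'a \<Rightarrow> nat \<Rightarrow> nat" where
  "color_degree G v c = card {e \<in> hyperedges G. v \<in> members G e \<and> edge_label G e = c}"

text \<open>A clustering is represented by its color assignment; values outside the node set
  are unconstrained and affect none of the notions below.\<close>

definition clustering :: "('a, 'e) hypergraph \<Rightarrow> ('a \<Rightarrow> nat) \<Rightarrow> bool" where
  "clustering G C \<longleftrightarrow> C \<in> nodes G \<rightarrow> labels G"

definition cluster :: "('a, 'e) hypergraph \<Rightarrow> ('a \<Rightarrow> nat) \<Rightarrow> nat \<Rightarrow> 'a set" where
  "cluster G C i = {v \<in> nodes G. C v = i}"

definition majority_vote_clustering :: "('a, 'e) hypergraph \<Rightarrow> ('a \<Rightarrow> nat) \<Rightarrow> bool" where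
  "majority_vote_clustering G C \<longleftrightarrow> clustering G C \<and>
     (\<forall>v\<in>nodes G. is_arg_max (color_degree G v) (\<lambda>c. c \<in> labels G) (C v))"

definition minority_vote_clustering :: "('a, 'e) hypergraph \<Rightarrow> ('a \<Rightarrow> nat) \<Rightarrow> bool" where
  "minority_vote_clustering G C \<longleftrightarrow> clustering G C \<and>
     (\<forall>v\<in>nodes G. is_arg_min (color_degree G v) (\<lambda>c. c \<in> labels G) (C v))"

text \<open>The quantities $E(i)$ and $D(i)$ for the cluster of color $i$.\<close>

definition experience :: "('a, 'e) hypergraph \<Rightarrow> ('a \<Rightarrow> nat) \<Rightarrow> nat \<Rightarrow> nat" where
  "experience G C i = (\<Sum>v\<in>cluster G C i. color_degree G v i)"

definition diversity :: "('a, 'e) hypergraph \<Rightarrow> ('a \<Rightarrow> nat) \<Rightarrow> nat \<Rightarrow> nat" where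
  "diversity G C i = (\<Sum>v\<in>cluster G C i. \<Sum>c\<in>labels G - {i}. color_degree G v c)"

definition objective :: "('a, 'e) hypergraph \<Rightarrow> real \<Rightarrow> ('a \<Rightarrow> nat) \<Rightarrow> real" where
  "objective G \<beta> C =
     (\<Sum>i\<in>labels G. real (experience G C i) + \<beta> * real (diversity G C i))"

definition optimal_clustering :: "('a, 'e) hypergraph \<Rightarrow> real \<Rightarrow> ('a \<Rightarrow> nat) \<Rightarrow> bool" where
  "optimal_clustering G \<beta> C \<longleftrightarrow> is_arg_max (objective G \<beta>) (clustering G) C"

end

(* Grouping the objective by nodes, node v contributes d + beta * (T v - d) = beta * T v + (1 - beta) * d,
   where d is its degree in its own color and T v the sum of its degrees over all colors. Only the second
   term depends on the clustering, so the sign of 1 - beta decides whether to maximize or minimize d. *)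

theory Submission
  imports Defs
begin

lemma finite_labels [simp]: "finite (labels G)"
  by (simp add: labels_def)

text \<open>The clusters of the colors in \<open>labels G\<close> partition the nodes, since a
  clustering sends every node to a label.\<close>

lemma sum_over_clusters:
  fixes f :: "'a \<Rightarrow> nat \<Rightarrow> 'b::comm_monoid_add"
  assumes "finite (nodes G)" "clustering G C"
  shows "(\<Sum>i\<in>labels G. \<Sum>v\<in>cluster G C i. f v i) = (\<Sum>v\<in>nodes G. f v (C v))"
proof -
  \<comment> \<open>Replacing \<open>i\<close> by \<open>C v\<close> makes the summand independent
    of the color, the form that \<open>sum.group\<close> expects.\<close>
  have "(\<Sum>i\<in>labels G. \<Sum>v\<in>cluster G C i. f v i) =
        (\<Sum>i\<in>labels G. \<Sum>v\<in>{v\<in>nodes G. C v = i}. f v (C v))"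
    by (intro sum.cong) (auto simp: cluster_def)
  also have "\<dots> = (\<Sum>v\<in>nodes G. f v (C v))"
    using assms by (intro sum.group) (auto simp: clustering_def)
  finally show ?thesis .
qed

lemma objective_eq:
  assumes "finite (nodes G)" and C: "clustering G C"
  shows "objective G \<beta> C =
           \<beta> * (\<Sum>v\<in>nodes G. \<Sum>c\<in>labels G. real (color_degree G v c)) +
           (\<Sum>v\<in>nodes G. (1 - \<beta>) * real (color_degree G v (C v)))"
proof -
  \<comment> \<open>Both parts of the objective are merged into one summand in \<open>v\<close> and
    \<open>i\<close>, ready for \<open>sum_over_clusters\<close>.\<close>
  have "objective G \<beta> C =
      (\<Sum>i\<in>labels G. \<Sum>v\<in>cluster G C i. real (color_degree G v i) +
         \<beta> * (\<Sum>c\<in>labels G - {i}. real (color_degree G v c)))"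
    by (simp add: objective_def experience_def diversity_def sum.distrib sum_distrib_left)
  also have "\<dots> = (\<Sum>v\<in>nodes G. real (color_degree G v (C v)) +
         \<beta> * (\<Sum>c\<in>labels G - {C v}. real (color_degree G v c)))"
    using assms by (rule sum_over_clusters)
  also have "\<dots> = (\<Sum>v\<in>nodes G. \<beta> * (\<Sum>c\<in>labels G. real (color_degree G v c)) +
         (1 - \<beta>) * real (color_degree G v (C v)))"
  proof (rule sum.cong)
    fix v assume "v \<in> nodes G"
    \<comment> \<open>Only for a color in \<open>labels G\<close> does \<open>sum_diff1\<close>
      subtract exactly the degree of \<open>v\<close> in its own color.\<close>
    then have "C v \<in> labels G"
      using C by (auto simp: clustering_def)
    then show "real (color_degree G v (C v)) + \<beta> * (\<Sum>c\<in>labels G - {C v}. real (color_degree G v c)) =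
        \<beta> * (\<Sum>c\<in>labels G. real (color_degree G v c)) + (1 - \<beta>) * real (color_degree G v (C v))"
      by (simp add: sum_diff1 algebra_simps)
  qed simp
  finally show ?thesis
    by (simp add: sum.distrib sum_distrib_left)
qed

text \<open>By \<open>objective_eq\<close>, two clusterings share the first summand, so a comparison
  node by node suffices. Keeping the factor 1 - \<beta> in the hypothesis lets one lemma serve both
  signs.\<close>

lemma optimal_clusteringI:
  assumes "finite (nodes G)" and C: "clustering G C"
    and le: "\<And>v c. v \<in> nodes G \<Longrightarrow> c \<in> labels G \<Longrightarrow>
      (1 - \<beta>) * real (color_degree G v c) \<le> (1 - \<beta>) * real (color_degree G v (C v))"
  shows "optimal_clustering G \<beta> C"
proof -
  have "objective G \<beta> C' \<le> objective G \<beta> C" if C': "clustering G C'" for C'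
    unfolding objective_eq[OF assms(1) C] objective_eq[OF assms(1) C']
    using C' by (intro add_left_mono sum_mono le) (auto simp: clustering_def)
  then show ?thesis
    using C by (auto simp: optimal_clustering_def is_arg_max_linorder)
qed

text \<open>Here 1 - \<beta> is nonnegative, so the largest degree gives the largest contribution.
  The bound is weak to include the case \<beta> = 1.\<close>

lemma majority_vote_optimal:
  assumes "finite (nodes G)" "majority_vote_clustering G C" "\<beta> \<le> 1"
  shows "optimal_clustering G \<beta> C"
  using assms
  by (intro optimal_clusteringI mult_left_mono)
     (auto simp: majority_vote_clustering_def is_arg_max_linorder)

text \<open>Now 1 - \<beta> is at most 0, so multiplying by it reverses the inequality between
  degrees.\<close>

lemma minority_vote_optimal:
  assumes "finite (nodes G)" "minority_vote_clustering G C" "\<beta> \<ge> 1"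
  shows "optimal_clustering G \<beta> C"
  using assms
  by (intro optimal_clusteringI mult_left_mono_neg)
     (auto simp: minority_vote_clustering_def is_arg_min_linorder)

theorem theorem1:
  fixes G :: "('a, 'e) hypergraph"
  assumes "labeled_hypergraph G"
  shows "(\<forall>\<beta><1. \<forall>C. majority_vote_clustering G C \<longrightarrow> optimal_clustering G \<beta> C) \<and>
         (\<forall>\<beta>>1. \<forall>C. minority_vote_clustering G C \<longrightarrow> optimal_clustering G \<beta> C) \<and>
         (\<forall>C. majority_vote_clustering G C \<longrightarrow> optimal_clustering G 1 C) \<and>
         (\<forall>C. minority_vote_clustering G C \<longrightarrow> optimal_clustering G 1 C)"
  using assms
  by (auto simp: labeled_hypergraph_def intro: majority_vote_optimal minority_vote_optimal)

end
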